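(* Let $P_0$ and $R_0$ be non-isomorphic posets, each of size $m$, and let $i>m$. Then $D_{m+i+1}(P_iR_i)$ is a node of covtree consisting of $k=C(P_0R_0)+\lceil (i-m)/2\rceil$ posets of size $n=m+i+1$, and the smallest witness of this node has size $|P_iR_i|=2m+2i$. Consequently, for any constant $c$, $|P_iR_i|>n+k+c$ whenever $i-\lceil (i-m)/2\rceil>1+C(P_0R_0)-m+c$.
   Context: For $i\ge 0$, $P_i$ (resp. $R_i$) is obtained by placing $P_0$ (resp. $R_0$) above a chain of $i$ elements, and $P_iR_i$ is their disjoint union. A downset is a downward-closed subset; $D(P)$ is the set of non-empty downsets of $P$ up to isomorphism and $D_n(P)$ those of size $n$. $C(P_0R_0):=|D(P_0)|+|D(R_0)|-|D(P_0)\cap D(R_0)|$. A poset $Q$ is a witness of a set $\Gamma_n$ of unlabelled posets of size $n$ if $D_n(Q)=\Gamma_n$; a node of covtree is such a set $\Gamma_n$ that has at least one witness. *)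

theory Defs
  imports Complex_Main
begin

text \<open>Finite posets are represented concretely with carrier a finite set of naturals
  and order relation a set of pairs (reflexive on the carrier).  Unlabelled posets are
  isomorphism classes of such posets.\<close>

type_synonym npos = "nat set \<times> (nat \<times> nat) set"

definition is_poset :: "npos \<Rightarrow> bool" where
  "is_poset P \<longleftrightarrow> finite (fst P) \<and> snd P \<subseteq> fst P \<times> fst P \<and>
     refl_on (fst P) (snd P) \<and> antisym (snd P) \<and> trans (snd P)"

definition psize :: "npos \<Rightarrow> nat" where
  "psize P = card (fst P)"

definition pos_iso :: "npos \<Rightarrow> npos \<Rightarrow> bool" where
  "pos_iso P Q \<longleftrightarrow> (\<exists>f. bij_betw f (fst P) (fst Q) \<and>
     (\<forall>x\<in>fst P. \<forall>y\<in>fst P. (x, y) \<in> snd P \<longleftrightarrow> (f x, f y) \<in> snd Q))"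

definition iso_class :: "npos \<Rightarrow> npos set" where
  "iso_class P = {Q. is_poset Q \<and> pos_iso P Q}"

definition is_downset :: "npos \<Rightarrow> nat set \<Rightarrow> bool" where
  "is_downset P S \<longleftrightarrow> S \<subseteq> fst P \<and> (\<forall>x\<in>S. \<forall>y\<in>fst P. (y, x) \<in> snd P \<longrightarrow> y \<in> S)"

definition induced :: "npos \<Rightarrow> nat set \<Rightarrow> npos" where
  "induced P S = (S, snd P \<inter> (S \<times> S))"

definition Dsets :: "npos \<Rightarrow> npos set set" where
  "Dsets P = {iso_class (induced P S) | S. is_downset P S \<and> S \<noteq> {}}"

definition Dn :: "nat \<Rightarrow> npos \<Rightarrow> npos set set" where
  "Dn n P = {iso_class (induced P S) | S. is_downset P S \<and> S \<noteq> {} \<and> card S = n}"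

definition map_pos :: "(nat \<Rightarrow> nat) \<Rightarrow> npos \<Rightarrow> npos" where
  "map_pos f P = (f ` fst P, (\<lambda>(x, y). (f x, f y)) ` snd P)"

definition chain :: "nat \<Rightarrow> npos" where
  "chain i = ({0..<i}, {(a, b). a \<le> b \<and> b < i})"

text \<open>P_i: P placed above a chain of i elements (every element of P lies above every
  chain element).  Chain elements are encoded as even, P's elements as odd numbers.\<close>
definition above_chain :: "npos \<Rightarrow> nat \<Rightarrow> npos" where
  "above_chain P i =
    (let C = map_pos (\<lambda>x. 2 * x) (chain i); Q = map_pos (\<lambda>x. 2 * x + 1) P
     in (fst C \<union> fst Q, snd C \<union> snd Q \<union> (fst C \<times> fst Q)))"

definition disj_union :: "npos \<Rightarrow> npos \<Rightarrow> npos" where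
  "disj_union P Q =
    (let P' = map_pos (\<lambda>x. 2 * x) P; Q' = map_pos (\<lambda>x. 2 * x + 1) Q
     in (fst P' \<union> fst Q', snd P' \<union> snd Q'))"

definition Cconst :: "npos \<Rightarrow> npos \<Rightarrow> nat" where
  "Cconst P R = card (Dsets P) + card (Dsets R) - card (Dsets P \<inter> Dsets R)"

definition is_witness :: "nat \<Rightarrow> npos set set \<Rightarrow> npos \<Rightarrow> bool" where
  "is_witness n \<Gamma> Q \<longleftrightarrow> is_poset Q \<and> Dn n Q = \<Gamma>"

definition is_covtree_node :: "nat \<Rightarrow> npos set set \<Rightarrow> bool" where
  "is_covtree_node n \<Gamma> \<longleftrightarrow> (\<exists>Q. is_witness n \<Gamma> Q)"

end

(*
  Write n = m + i + 1.  An n-element downset of P_i R_i either consists of the bottom a and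
  n - a elements of the two chains (m < a <= i), or of one whole tower, a non-empty downset D
  of the poset on top of it, and the bottom m + 1 - |D| elements of the other chain.  Counting
  strict predecessors tells the two kinds apart and identifies the first kind up to swapping
  a and n - a, which leaves ceil((i - m) / 2) classes; in the second kind the elements with at
  least i strict predecessors form a copy of D, which leaves C(P_0 R_0) classes.

  For minimality, a witness Q must contain downsets A and B isomorphic to the two downsets with
  D = P_0 and D = R_0.  Each is an isolated point beside a poset with a least element, they are
  not isomorphic, and no n-element downset of Q has a least element.  If A and B had the same
  root, exchanging the isolated points would make them isomorphic, or adding to A a minimal
  element of B outside A would create a rooted n-element downset.  So the roots differ, A and B
  share at most their isolated points, and |Q| >= |A \<union> B| >= 2n - 2 = 2m + 2i.
*)
theory Submission
  imports Defs
begin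

section \<open>Isomorphism of finite posets\<close>

lemma pos_iso_refl: "pos_iso P P"
  unfolding pos_iso_def by (rule exI[of _ id]) auto

lemma pos_iso_sym: assumes "pos_iso P Q" shows "pos_iso Q P"
proof -
  obtain f where f: "bij_betw f (fst P) (fst Q)"
    "\<forall>x\<in>fst P. \<forall>y\<in>fst P. (x, y) \<in> snd P \<longleftrightarrow> (f x, f y) \<in> snd Q"
    using assms unfolding pos_iso_def by blast
  let ?g = "the_inv_into (fst P) f"
  have g: "bij_betw ?g (fst Q) (fst P)" using f(1) by (rule bij_betw_the_inv_into)
  have "(x, y) \<in> snd Q \<longleftrightarrow> (?g x, ?g y) \<in> snd P" if "x \<in> fst Q" "y \<in> fst Q" for x y
  proof -
    have "?g x \<in> fst P" "?g y \<in> fst P" using g that by (auto intro: bij_betw_apply)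
    moreover have "f (?g x) = x" "f (?g y) = y"
      using f(1) that by (auto intro: f_the_inv_into_f_bij_betw)
    ultimately show ?thesis using f(2) by metis
  qed
  then show ?thesis using g unfolding pos_iso_def by blast
qed

lemma pos_iso_trans: assumes "pos_iso P Q" "pos_iso Q R" shows "pos_iso P R"
proof -
  obtain f where f: "bij_betw f (fst P) (fst Q)"
    "\<forall>x\<in>fst P. \<forall>y\<in>fst P. (x, y) \<in> snd P \<longleftrightarrow> (f x, f y) \<in> snd Q"
    using assms unfolding pos_iso_def by blast
  obtain g where g: "bij_betw g (fst Q) (fst R)"
    "\<forall>x\<in>fst Q. \<forall>y\<in>fst Q. (x, y) \<in> snd Q \<longleftrightarrow> (g x, g y) \<in> snd R"
    using assms unfolding pos_iso_def by blast
  have "bij_betw (g \<circ> f) (fst P) (fst R)" using f g by (metis bij_betw_trans)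
  moreover have "\<forall>x\<in>fst P. \<forall>y\<in>fst P. (x, y) \<in> snd P \<longleftrightarrow> ((g \<circ> f) x, (g \<circ> f) y) \<in> snd R"
    using f g by (auto dest: bij_betwE)
  ultimately show ?thesis unfolding pos_iso_def by blast
qed

lemma pos_iso_inducedI:
  assumes "bij_betw f A B" "\<And>x y. x \<in> A \<Longrightarrow> y \<in> A \<Longrightarrow> (x, y) \<in> snd P \<longleftrightarrow> (f x, f y) \<in> snd Q"
  shows "pos_iso (induced P A) (induced Q B)"
  using assms unfolding pos_iso_def induced_def by (auto dest: bij_betwE)

lemma pos_iso_inducedE:
  assumes "pos_iso (induced P A) (induced Q B)"
  obtains f where "bij_betw f A B" "\<And>x y. x \<in> A \<Longrightarrow> y \<in> A \<Longrightarrow> (x, y) \<in> snd P \<longleftrightarrow> (f x, f y) \<in> snd Q"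
proof -
  obtain f where f: "bij_betw f A B"
    "\<forall>x\<in>A. \<forall>y\<in>A. (x, y) \<in> snd P \<inter> A \<times> A \<longleftrightarrow> (f x, f y) \<in> snd Q \<inter> B \<times> B"
    using assms unfolding pos_iso_def induced_def fst_conv snd_conv by blast
  then show thesis using that bij_betw_apply[OF f(1)] by blast
qed

lemma iso_class_eq: "pos_iso P Q \<Longrightarrow> iso_class P = iso_class Q"
  unfolding iso_class_def using pos_iso_sym pos_iso_trans by blast

lemma iso_class_eqD: "iso_class P = iso_class Q \<Longrightarrow> is_poset Q \<Longrightarrow> pos_iso P Q"
  unfolding iso_class_def using pos_iso_refl by blast

lemma induced_poset: "is_poset P \<Longrightarrow> S \<subseteq> fst P \<Longrightarrow> is_poset (induced P S)"
  unfolding is_poset_def induced_def refl_on_def antisym_def trans_def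
  by (auto intro: finite_subset)

lemma induced_carrier: "is_poset P \<Longrightarrow> induced P (fst P) = P"
  unfolding is_poset_def induced_def by (metis Int_absorb2 prod.collapse)

lemma psize_iso: "pos_iso P Q \<Longrightarrow> psize P = psize Q"
  unfolding pos_iso_def psize_def by (auto intro: bij_betw_same_card)

lemma psize_Dn_member: "X \<in> Dn n P \<Longrightarrow> Q \<in> X \<Longrightarrow> psize Q = n"
  unfolding Dn_def iso_class_def
  by (auto dest!: psize_iso simp: psize_def induced_def)

lemma finite_Dsets: "is_poset P \<Longrightarrow> finite (Dsets P)"
proof -
  assume "is_poset P"
  then have "finite ((\<lambda>S. iso_class (induced P S)) ` Pow (fst P))"
    by (simp add: is_poset_def)
  moreover have "Dsets P \<subseteq> (\<lambda>S. iso_class (induced P S)) ` Pow (fst P)"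
    unfolding Dsets_def is_downset_def by auto
  ultimately show ?thesis by (rule finite_subset[rotated])
qed

lemma card_image_eq_if_same_kernel:
  assumes "\<And>x y. x \<in> I \<Longrightarrow> y \<in> I \<Longrightarrow> f x = f y \<longleftrightarrow> g x = g y"
  shows "card (f ` I) = card (g ` I)"
proof -
  let ?h = "\<lambda>z. g (inv_into I f z)"
  have h: "?h (f x) = g x" if "x \<in> I" for x
  proof -
    have fx: "f x \<in> f ` I" using that by (rule imageI)
    have "inv_into I f (f x) \<in> I" "f (inv_into I f (f x)) = f x"
      using inv_into_into[OF fx] f_inv_into_f[OF fx] by auto
    then show ?thesis using assms that by blast
  qed
  have "inj_on ?h (f ` I)"
    using assms h by (auto intro!: inj_onI)
  moreover have "?h ` f ` I = g ` I"
    using h by (simp add: image_image)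
  ultimately show ?thesis by (metis card_image)
qed

section \<open>Isomorphism invariants\<close>

definition below_count :: "npos \<Rightarrow> nat \<Rightarrow> nat" where
  "below_count Q x = card {y \<in> fst Q. (y, x) \<in> snd Q \<and> y \<noteq> x}"

definition has_deep_elem :: "nat \<Rightarrow> npos \<Rightarrow> bool" where
  "has_deep_elem t Q \<longleftrightarrow> (\<exists>x\<in>fst Q. t \<le> below_count Q x)"

definition deep_part :: "nat \<Rightarrow> npos \<Rightarrow> npos" where
  "deep_part t Q = induced Q {x \<in> fst Q. t \<le> below_count Q x}"

definition has_least :: "npos \<Rightarrow> bool" where
  "has_least Q \<longleftrightarrow> (\<exists>l\<in>fst Q. \<forall>x\<in>fst Q. (l, x) \<in> snd Q)"

lemma below_count_iso:
  assumes f: "bij_betw f (fst Q) (fst Q')"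
    "\<forall>x\<in>fst Q. \<forall>y\<in>fst Q. (x, y) \<in> snd Q \<longleftrightarrow> (f x, f y) \<in> snd Q'"
    and x: "x \<in> fst Q"
  shows "below_count Q' (f x) = below_count Q x"
proof -
  have "fst Q' = f ` fst Q" using f(1) by (simp add: bij_betw_def)
  then have "{y \<in> fst Q'. (y, f x) \<in> snd Q' \<and> y \<noteq> f x} =
      f ` {y \<in> fst Q. (y, x) \<in> snd Q \<and> y \<noteq> x}"
    using f x by (auto simp: bij_betw_def inj_on_def)
  moreover have "inj_on f {y \<in> fst Q. (y, x) \<in> snd Q \<and> y \<noteq> x}"
    using f(1) by (auto simp: bij_betw_def intro: inj_on_subset)
  ultimately show ?thesis unfolding below_count_def by (simp add: card_image)
qed

lemma has_deep_elem_iso: assumes "pos_iso Q Q'" "has_deep_elem t Q" shows "has_deep_elem t Q'"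
proof -
  obtain f where f: "bij_betw f (fst Q) (fst Q')"
    "\<forall>x\<in>fst Q. \<forall>y\<in>fst Q. (x, y) \<in> snd Q \<longleftrightarrow> (f x, f y) \<in> snd Q'"
    using assms unfolding pos_iso_def by blast
  obtain x where x: "x \<in> fst Q" "t \<le> below_count Q x"
    using assms(2) unfolding has_deep_elem_def by blast
  have "f x \<in> fst Q'" using f(1) x(1) by (rule bij_betw_apply)
  then show ?thesis using x(2) below_count_iso[OF f x(1)] unfolding has_deep_elem_def
    by (intro bexI[of _ "f x"]) simp_all
qed

lemma has_least_iso: assumes "pos_iso Q Q'" "has_least Q" shows "has_least Q'"
proof -
  obtain f where f: "bij_betw f (fst Q) (fst Q')"
    "\<forall>x\<in>fst Q. \<forall>y\<in>fst Q. (x, y) \<in> snd Q \<longleftrightarrow> (f x, f y) \<in> snd Q'"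
    using assms unfolding pos_iso_def by blast
  obtain l where l: "l \<in> fst Q" "\<forall>x\<in>fst Q. (l, x) \<in> snd Q"
    using assms(2) unfolding has_least_def by blast
  have Q': "fst Q' = f ` fst Q" using f(1) by (simp add: bij_betw_def)
  have "(f l, f x) \<in> snd Q'" if "x \<in> fst Q" for x
    using that f(2) l by simp
  then show ?thesis using l(1) unfolding has_least_def Q' by blast
qed

lemma deep_part_iso: assumes "pos_iso Q Q'" shows "pos_iso (deep_part t Q) (deep_part t Q')"
proof -
  obtain f where f: "bij_betw f (fst Q) (fst Q')"
    "\<forall>x\<in>fst Q. \<forall>y\<in>fst Q. (x, y) \<in> snd Q \<longleftrightarrow> (f x, f y) \<in> snd Q'"
    using assms unfolding pos_iso_def by blast
  let ?K = "{x \<in> fst Q. t \<le> below_count Q x}" and ?K' = "{x \<in> fst Q'. t \<le> below_count Q' x}"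
  have Q': "fst Q' = f ` fst Q" using f(1) by (simp add: bij_betw_def)
  have "?K' = f ` ?K"
    unfolding Q' by (auto simp: below_count_iso[OF f])
  then have "bij_betw f ?K ?K'"
    using f(1) by (auto simp: bij_betw_def intro: inj_on_subset)
  then show ?thesis unfolding deep_part_def
  proof (rule pos_iso_inducedI)
    fix x y assume "x \<in> ?K" "y \<in> ?K"
    then show "(x, y) \<in> snd Q \<longleftrightarrow> (f x, f y) \<in> snd Q'" using f(2) by blast
  qed
qed

section \<open>An isolated point beside a rooted poset\<close>

definition point_plus_rooted :: "npos \<Rightarrow> nat set \<Rightarrow> nat \<Rightarrow> nat \<Rightarrow> bool" where
  "point_plus_rooted Q A u v \<longleftrightarrow> u \<in> A \<and> v \<in> A \<and> u \<noteq> v \<and>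
     (\<forall>z\<in>A. z \<noteq> u \<longrightarrow> (u, z) \<notin> snd Q \<and> (z, u) \<notin> snd Q \<and> (v, z) \<in> snd Q)"

lemma point_plus_rooted_iso:
  assumes "pos_iso (induced Q' A') (induced Q A)" "point_plus_rooted Q' A' u v"
  shows "\<exists>u v. point_plus_rooted Q A u v"
proof -
  obtain f where f: "bij_betw f A' A"
    and le: "\<And>x y. x \<in> A' \<Longrightarrow> y \<in> A' \<Longrightarrow> (x, y) \<in> snd Q' \<longleftrightarrow> (f x, f y) \<in> snd Q"
    using pos_iso_inducedE[OF assms(1)] by blast
  have "point_plus_rooted Q A (f u) (f v)"
    unfolding point_plus_rooted_def
  proof (intro conjI ballI impI)
    show "f u \<in> A" "f v \<in> A" "f u \<noteq> f v"
      using assms(2) f unfolding point_plus_rooted_def bij_betw_def inj_on_def by auto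
  next
    fix z assume "z \<in> A" "z \<noteq> f u"
    then obtain z' where "z' \<in> A'" "z = f z'" "z' \<noteq> u" using f unfolding bij_betw_def by auto
    then show "(f u, z) \<notin> snd Q" "(z, f u) \<notin> snd Q" "(f v, z) \<in> snd Q"
      using assms(2) le unfolding point_plus_rooted_def by auto
  qed
  then show ?thesis by blast
qed

lemma finite_poset_has_minimal:
  assumes Q: "is_poset Q" and S: "finite S" "S \<noteq> {}" "S \<subseteq> fst Q"
  shows "\<exists>w\<in>S. \<forall>z\<in>S. (z, w) \<in> snd Q \<longrightarrow> z = w"
  using S
proof (induction S rule: finite_ne_induct)
  case (insert x S)
  then obtain w where w: "w \<in> S" "\<forall>z\<in>S. (z, w) \<in> snd Q \<longrightarrow> z = w" by auto
  have "trans (snd Q)" "antisym (snd Q)" using Q by (auto simp: is_poset_def)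
  then have "\<forall>z\<in>insert x S. (z, x) \<in> snd Q \<longrightarrow> z = x" if "(x, w) \<in> snd Q" "x \<noteq> w"
    using w that by (metis antisymD insert_iff transD)
  then show ?case using w by blast
qed simp

lemma point_plus_rooted_same_rest_iso:
  assumes "refl_on (fst Q) (snd Q)" "A \<subseteq> fst Q" "B \<subseteq> fst Q"
    and "point_plus_rooted Q A uA vA" "point_plus_rooted Q B uB vB" "A - {uA} = B - {uB}"
  shows "pos_iso (induced Q A) (induced Q B)"
proof (rule pos_iso_inducedI[where f = "\<lambda>z. if z = uA then uB else z"])
  show "bij_betw (\<lambda>z. if z = uA then uB else z) A B"
    using assms(4-6) unfolding point_plus_rooted_def bij_betw_def inj_on_def by auto
  have "(uA, uA) \<in> snd Q" "(uB, uB) \<in> snd Q"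
    using assms(1-5) unfolding refl_on_def point_plus_rooted_def by auto
  then show "(x, y) \<in> snd Q \<longleftrightarrow> ((if x = uA then uB else x), (if y = uA then uB else y)) \<in> snd Q"
    if "x \<in> A" "y \<in> A" for x y
    using that assms(4-6) unfolding point_plus_rooted_def by auto
qed

lemma point_plus_rooted_common_root:
  assumes Q: "is_poset Q"
    and A: "is_downset Q A" "point_plus_rooted Q A uA v"
    and B: "is_downset Q B" "point_plus_rooted Q B uB v"
    and card: "card A = card B" and rest: "A - {uA} \<noteq> B - {uB}"
  obtains T where "is_downset Q T" "card T = card A" "has_least (induced Q T)"
proof -
  define YA where "YA = A - {uA}"
  define YB where "YB = B - {uB}"
  have finAB: "finite A" "finite B"
    using Q A(1) B(1) unfolding is_poset_def is_downset_def by (auto intro: finite_subset)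
  then have fin: "finite YA" "finite YB" unfolding YA_def YB_def by simp_all
  have u: "uA \<in> A" "uB \<in> B" using A(2) B(2) unfolding point_plus_rooted_def by simp_all
  have cardA: "card A = Suc (card YA)"
    unfolding YA_def by (rule card_Suc_Diff1[OF finAB(1) u(1), symmetric])
  have "card B = Suc (card YB)"
    unfolding YB_def by (rule card_Suc_Diff1[OF finAB(2) u(2), symmetric])
  then have "card YA = card YB" using card cardA by simp
  then have "\<not> YB \<subseteq> YA" using rest card_subset_eq[OF fin(1)] unfolding YA_def YB_def by metis
  then obtain w where w: "w \<in> YB - YA" "\<forall>z\<in>YB - YA. (z, w) \<in> snd Q \<longrightarrow> z = w"
    using finite_poset_has_minimal[OF Q, of "YB - YA"] fin B(1)
    unfolding YB_def is_downset_def by auto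
  let ?T = "insert w YA"
  have "is_downset Q ?T"
    unfolding is_downset_def
  proof (intro conjI ballI impI)
    show "?T \<subseteq> fst Q" using w A(1) B(1) unfolding YA_def YB_def is_downset_def by auto
  next
    fix t z assume t: "t \<in> ?T" and z: "z \<in> fst Q" "(z, t) \<in> snd Q"
    show "z \<in> ?T"
    proof (cases "t = w")
      case True
      then have "z \<in> YB" using B z w unfolding is_downset_def point_plus_rooted_def YB_def by auto
      then show ?thesis using w z True by auto
    next
      case False
      then show ?thesis using t A z unfolding is_downset_def point_plus_rooted_def YA_def by auto
    qed
  qed
  moreover have "card ?T = card A" using w fin cardA by simp
  moreover have "has_least (induced Q ?T)"
    unfolding has_least_def induced_def
    using A(2) B(2) w unfolding point_plus_rooted_def YA_def YB_def by auto
  ultimately show thesis by (rule that)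
qed

lemma point_plus_rooted_Int_subset:
  assumes "antisym (snd Q)"
    and A: "is_downset Q A" "point_plus_rooted Q A uA vA"
    and B: "is_downset Q B" "point_plus_rooted Q B uB vB"
    and "vA \<noteq> vB"
  shows "A \<inter> B \<subseteq> {uA, uB}"
proof (rule ccontr)
  assume "\<not> A \<inter> B \<subseteq> {uA, uB}"
  then obtain z where z: "z \<in> A" "z \<in> B" "z \<noteq> uA" "z \<noteq> uB" by blast
  have below: "(vA, z) \<in> snd Q" "(vB, z) \<in> snd Q"
    using z A(2) B(2) unfolding point_plus_rooted_def by auto
  have "vA \<in> fst Q" "vB \<in> fst Q"
    using A B unfolding is_downset_def point_plus_rooted_def by auto
  then have "vB \<in> A" "vA \<in> B" using z below A(1) B(1) unfolding is_downset_def by blast+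
  moreover have "vB \<noteq> uA" "vA \<noteq> uB"
    using A(2) B(2) below z unfolding point_plus_rooted_def by blast+
  ultimately have "(vA, vB) \<in> snd Q" "(vB, vA) \<in> snd Q"
    using A(2) B(2) unfolding point_plus_rooted_def by blast+
  then show False using assms(1,6) by (metis antisymD)
qed

lemma card_Un_point_plus_rooted_downsets:
  assumes Q: "is_poset Q"
    and A: "is_downset Q A" "card A = n" "point_plus_rooted Q A uA vA"
    and B: "is_downset Q B" "card B = n" "point_plus_rooted Q B uB vB"
    and not_iso: "\<not> pos_iso (induced Q A) (induced Q B)"
    and no_least: "\<And>T. is_downset Q T \<Longrightarrow> card T = n \<Longrightarrow> \<not> has_least (induced Q T)"
  shows "2 * n - 2 \<le> card (A \<union> B)"
proof -
  have "vA \<noteq> vB"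
  proof
    assume v: "vA = vB"
    show False
    proof (cases "A - {uA} = B - {uB}")
      case True
      then show False using point_plus_rooted_same_rest_iso[OF _ _ _ A(3) B(3)] not_iso Q A(1) B(1)
        unfolding is_poset_def is_downset_def by blast
    next
      case False
      then show False using point_plus_rooted_common_root[OF Q A(1,3) B(1)] B(3) v A(2) B(2) no_least
        by metis
    qed
  qed
  then have "A \<inter> B \<subseteq> {uA, uB}"
    using point_plus_rooted_Int_subset[OF _ A(1,3) B(1,3)] Q unfolding is_poset_def by blast
  then have "card (A \<inter> B) \<le> card {uA, uB}" by (rule card_mono[rotated]) simp
  also have "\<dots> \<le> 2" by (simp add: card_insert_if)
  finally have "card (A \<inter> B) \<le> 2" .
  moreover have "finite A" "finite B"
    using Q A(1) B(1) unfolding is_poset_def is_downset_def by (auto intro: finite_subset)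
  then have "card (A \<union> B) + card (A \<inter> B) = card A + card B" by (rule card_Un_Int[symmetric])
  ultimately show ?thesis using A(2) B(2) by linarith
qed

section \<open>The poset \<open>P\<^sub>i R\<^sub>i\<close>\<close>

datatype tower_elt = Chain bool nat | Top bool nat

text \<open>The labels that \<^const>\<open>disj_union\<close> and \<^const>\<open>above_chain\<close> give to the elements of
  \<open>P\<^sub>i R\<^sub>i\<close>: chain element \<open>j\<close> of the left (\<open>s = False\<close>) or right (\<open>s = True\<close>) tower becomes
  \<open>4 j + s\<close>, element \<open>p\<close> of the poset on top of that tower becomes \<open>4 p + 2 + s\<close>.\<close>
fun code :: "tower_elt \<Rightarrow> nat" where
  "code (Chain s j) = 4 * j + of_bool s"
| "code (Top s p) = 4 * p + 2 + of_bool s"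

lemma inj_code: "inj code"
proof (rule injI)
  fix a b assume "code a = code b"
  then show "a = b" by (cases a; cases b; auto simp: of_bool_def split: if_splits; presburger)
qed

lemma code_eq_iff [simp]: "code a = code b \<longleftrightarrow> a = b"
  using inj_code by (auto dest: injD)

lemma down_closed_nat_set_eq_lessThan:
  fixes A :: "nat set"
  assumes "finite A" "\<And>j k. j \<in> A \<Longrightarrow> k \<le> j \<Longrightarrow> k \<in> A"
  shows "A = {..<card A}"
proof (cases "A = {}")
  case False
  then have "Max A \<in> A" using assms(1) by (rule Max_in[rotated])
  then have "{..Max A} \<subseteq> A" using assms(2) by blast
  then have "A = {..Max A}" using assms(1) by auto
  then show ?thesis by (metis card_lessThan lessThan_Suc_atMost)
qed simp

definition chain_part :: "tower_elt set \<Rightarrow> bool \<Rightarrow> nat set" where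
  "chain_part T s = {j. Chain s j \<in> T}"

definition top_part :: "tower_elt set \<Rightarrow> bool \<Rightarrow> nat set" where
  "top_part T s = {p. Top s p \<in> T}"

lemma tower_set_decomp: "T = Chain s ` chain_part T s \<union> Chain (\<not> s) ` chain_part T (\<not> s) \<union>
    Top s ` top_part T s \<union> Top (\<not> s) ` top_part T (\<not> s)"
proof (intro equalityI subsetI)
  fix x assume "x \<in> T"
  then show "x \<in> Chain s ` chain_part T s \<union> Chain (\<not> s) ` chain_part T (\<not> s) \<union>
    Top s ` top_part T s \<union> Top (\<not> s) ` top_part T (\<not> s)"
    unfolding chain_part_def top_part_def by (cases x; rename_tac t j; case_tac "t = s"; auto)
qed (auto simp: chain_part_def top_part_def)

lemma card_tower_set:
  assumes "finite T"
  shows "card T = card (chain_part T s) + card (chain_part T (\<not> s)) +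
    card (top_part T s) + card (top_part T (\<not> s))"
proof -
  have "finite (Chain t -` T)" "finite (Top t -` T)" for t
    using assms by (auto intro: finite_vimageI simp: inj_def)
  then have "finite (chain_part T t)" "finite (top_part T t)" for t
    unfolding chain_part_def top_part_def vimage_def by simp_all
  then show ?thesis
    by (subst tower_set_decomp[of T s], (subst card_Un_disjoint, auto)+)
      (simp add: card_image inj_on_def)
qed

fun relabel :: "bool \<Rightarrow> bool \<Rightarrow> (nat \<Rightarrow> nat) \<Rightarrow> tower_elt \<Rightarrow> tower_elt" where
  "relabel s t g (Chain b j) = Chain (if b = s then t else \<not> t) j"
| "relabel s t g (Top b p) = Top t (g p)"

locale two_towers =
  fixes P0 R0 :: npos and m i :: nat
  assumes P0: "is_poset P0" and R0: "is_poset R0" and not_iso: "\<not> pos_iso P0 R0"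
    and size_P0: "psize P0 = m" and size_R0: "psize R0 = m" and m_less_i: "m < i"
begin

definition top_poset :: "bool \<Rightarrow> npos" where
  "top_poset s = (if s then R0 else P0)"

definition PR :: npos where
  "PR = disj_union (above_chain P0 i) (above_chain R0 i)"

fun is_elt :: "tower_elt \<Rightarrow> bool" where
  "is_elt (Chain s j) \<longleftrightarrow> j < i"
| "is_elt (Top s p) \<longleftrightarrow> p \<in> fst (top_poset s)"

fun le_elt :: "tower_elt \<Rightarrow> tower_elt \<Rightarrow> bool" where
  "le_elt (Chain s j) (Chain t k) \<longleftrightarrow> s = t \<and> j \<le> k \<and> k < i"
| "le_elt (Chain s j) (Top t p) \<longleftrightarrow> s = t \<and> j < i \<and> p \<in> fst (top_poset s)"
| "le_elt (Top s p) (Top t q) \<longleftrightarrow> s = t \<and> (p, q) \<in> snd (top_poset s)"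
| "le_elt (Top s p) (Chain t k) \<longleftrightarrow> False"

lemma top_poset_False [simp]: "top_poset False = P0"
  and top_poset_True [simp]: "top_poset True = R0"
  by (simp_all add: top_poset_def)

lemma is_poset_top_poset: "is_poset (top_poset s)"
  using P0 R0 by (simp add: top_poset_def)

lemma elts_eq: "Collect is_elt =
    Chain False ` {..<i} \<union> Chain True ` {..<i} \<union> Top False ` fst P0 \<union> Top True ` fst R0"
proof (intro equalityI subsetI)
  fix a assume "a \<in> Collect is_elt"
  then show "a \<in> Chain False ` {..<i} \<union> Chain True ` {..<i} \<union> Top False ` fst P0 \<union> Top True ` fst R0"
    by (cases a; rename_tac s j; case_tac s; auto)
qed (auto simp: top_poset_def)

lemma fst_PR: "fst PR = code ` Collect is_elt"
  unfolding elts_eq PR_def disj_union_def above_chain_def map_pos_def chain_def Let_def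
  by (simp add: image_Un image_image atLeast0LessThan ac_simps)

lemma snd_PR: "snd PR = (\<lambda>(a, b). (code a, code b)) ` {(a, b). le_elt a b}"
proof -
  have "{(a, b). le_elt a b} =
      (\<lambda>(j, k). (Chain False j, Chain False k)) ` {(j, k). j \<le> k \<and> k < i} \<union>
      (\<lambda>(p, q). (Top False p, Top False q)) ` snd P0 \<union>
      (\<lambda>(j, p). (Chain False j, Top False p)) ` ({..<i} \<times> fst P0) \<union>
      (\<lambda>(j, k). (Chain True j, Chain True k)) ` {(j, k). j \<le> k \<and> k < i} \<union>
      (\<lambda>(p, q). (Top True p, Top True q)) ` snd R0 \<union>
      (\<lambda>(j, p). (Chain True j, Top True p)) ` ({..<i} \<times> fst R0)"
    (is "_ = ?U")
  proof (intro equalityI subsetI)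
    fix x assume "x \<in> {(a, b). le_elt a b}"
    then show "x \<in> ?U"
      by (cases x; rename_tac a b; case_tac a; case_tac b; rename_tac s j t k; case_tac s; force)
  qed auto
  then show ?thesis
    unfolding PR_def disj_union_def above_chain_def map_pos_def chain_def Let_def
    by (simp add: image_Un image_image atLeast0LessThan ac_simps split_beta
        image_paired_Times[symmetric])
qed


lemma code_le_PR_iff: "(code a, code b) \<in> snd PR \<longleftrightarrow> le_elt a b"
  unfolding snd_PR by auto

lemma top_poset_le_carrier: "(p, q) \<in> snd (top_poset s) \<Longrightarrow> p \<in> fst (top_poset s) \<and> q \<in> fst (top_poset s)"
  using is_poset_top_poset[of s] unfolding is_poset_def by blast

lemma le_elt_is_elt: "le_elt a b \<Longrightarrow> is_elt a \<and> is_elt b"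
  using top_poset_le_carrier by (cases a; cases b) auto

lemma le_elt_refl: "is_elt a \<Longrightarrow> le_elt a a"
  using is_poset_top_poset[unfolded is_poset_def refl_on_def] by (cases a) auto

lemma le_elt_antisym: "le_elt a b \<Longrightarrow> le_elt b a \<Longrightarrow> a = b"
  using is_poset_top_poset[unfolded is_poset_def antisym_def] by (cases a; cases b) auto

lemma le_elt_trans: assumes "le_elt a b" "le_elt b c" shows "le_elt a c"
proof -
  have "trans (snd (top_poset s))" for s using is_poset_top_poset[of s] unfolding is_poset_def by blast
  then show ?thesis using assms top_poset_le_carrier by (cases a; cases b; cases c) (auto dest: transD)
qed

lemma finite_elts: "finite (Collect is_elt)"
  unfolding elts_eq using P0 R0 by (simp add: is_poset_def)

lemma is_poset_PR: "is_poset PR"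
  unfolding is_poset_def
proof (intro conjI)
  show "finite (fst PR)" unfolding fst_PR using finite_elts by simp
  show "snd PR \<subseteq> fst PR \<times> fst PR"
    unfolding fst_PR snd_PR using le_elt_is_elt by auto
  show "refl_on (fst PR) (snd PR)"
    unfolding refl_on_def fst_PR snd_PR using le_elt_is_elt le_elt_refl by auto
  show "antisym (snd PR)"
    unfolding antisym_def snd_PR using le_elt_antisym by auto
  show "trans (snd PR)"
    unfolding trans_def snd_PR using le_elt_trans by auto
qed

lemma card_code_image: "card (code ` T) = card T"
  by (simp add: card_image inj_on_subset[OF inj_code])

lemma psize_PR: "psize PR = 2 * m + 2 * i"
proof -
  have fin: "finite (fst P0)" "finite (fst R0)" using P0 R0 by (simp_all add: is_poset_def)
  have "card (Collect is_elt) = card (Chain False ` {..<i}) + card (Chain True ` {..<i}) +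
      card (Top False ` fst P0) + card (Top True ` fst R0)"
    unfolding elts_eq using fin by (subst card_Un_disjoint, auto)+
  also have "\<dots> = i + i + m + m"
    using size_P0 size_R0 by (simp add: card_image inj_on_def psize_def)
  finally show ?thesis unfolding psize_def fst_PR card_code_image by simp
qed

definition down_closed :: "tower_elt set \<Rightarrow> bool" where
  "down_closed T \<longleftrightarrow> T \<subseteq> Collect is_elt \<and> (\<forall>b\<in>T. \<forall>a. le_elt a b \<longrightarrow> a \<in> T)"

definition PR_on :: "tower_elt set \<Rightarrow> npos" where
  "PR_on T = induced PR (code ` T)"

lemma is_downset_PR_code_iff: "is_downset PR (code ` T) \<longleftrightarrow> down_closed T"
  unfolding is_downset_def down_closed_def fst_PR
  by (auto simp: code_le_PR_iff inj_image_mem_iff[OF inj_code] inj_image_subset_iff[OF inj_code]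
      dest: le_elt_is_elt)

lemma Dn_PR: "Dn n PR = {iso_class (PR_on T) | T. down_closed T \<and> T \<noteq> {} \<and> card T = n}"
proof (intro equalityI subsetI)
  fix X assume "X \<in> Dn n PR"
  then obtain S where S: "X = iso_class (induced PR S)" "is_downset PR S" "S \<noteq> {}" "card S = n"
    unfolding Dn_def by blast
  have "S \<subseteq> range code" using S(2) unfolding is_downset_def fst_PR by auto
  then have "S = code ` (code -` S)" by blast
  then show "X \<in> {iso_class (PR_on T) | T. down_closed T \<and> T \<noteq> {} \<and> card T = n}"
    using S unfolding PR_on_def
    by (metis (mono_tags, lifting) card_code_image image_empty is_downset_PR_code_iff mem_Collect_eq)
next
  fix X assume "X \<in> {iso_class (PR_on T) | T. down_closed T \<and> T \<noteq> {} \<and> card T = n}"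
  then show "X \<in> Dn n PR"
    unfolding Dn_def PR_on_def by (auto simp: is_downset_PR_code_iff card_code_image)
qed

lemma is_poset_PR_on: "T \<subseteq> Collect is_elt \<Longrightarrow> is_poset (PR_on T)"
  unfolding PR_on_def using is_poset_PR fst_PR by (auto intro: induced_poset)

lemma PR_on_iso:
  assumes "bij_betw h T T'" "\<And>a b. a \<in> T \<Longrightarrow> b \<in> T \<Longrightarrow> le_elt (h a) (h b) \<longleftrightarrow> le_elt a b"
  shows "pos_iso (PR_on T) (PR_on T')"
proof -
  let ?f = "code \<circ> h \<circ> inv code"
  have "bij_betw ?f (code ` T) (code ` T')"
  proof -
    have "bij_betw (inv code) (code ` T) T"
      by (rule bij_betw_byWitness[where f' = code]) (auto simp: inv_f_f[OF inj_code])
    moreover have "bij_betw code T' (code ` T')"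
      by (simp add: bij_betw_imageI inj_on_subset[OF inj_code])
    ultimately show ?thesis using assms(1) by (metis bij_betw_trans)
  qed
  then show ?thesis unfolding PR_on_def
    by (rule pos_iso_inducedI) (auto simp: inv_f_f[OF inj_code] code_le_PR_iff assms(2))
qed

lemma below_count_PR_on:
  "a \<in> T \<Longrightarrow> below_count (PR_on T) (code a) = card {b \<in> T. le_elt b a \<and> b \<noteq> a}"
proof -
  assume "a \<in> T"
  then have "{y \<in> fst (PR_on T). (y, code a) \<in> snd (PR_on T) \<and> y \<noteq> code a} =
      code ` {b \<in> T. le_elt b a \<and> b \<noteq> a}"
    by (auto simp: PR_on_def induced_def code_le_PR_iff)
  then show ?thesis unfolding below_count_def by (simp add: card_code_image)
qed

declare code.simps [simp del]

lemma fst_PR_on: "fst (PR_on T) = code ` T"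
  by (simp add: PR_on_def induced_def)

subsection \<open>Downsets of size \<open>m + i + 1\<close>\<close>

lemma card_top_poset: "card (fst (top_poset s)) = m"
  using size_P0 size_R0 by (simp add: top_poset_def psize_def)

lemma downset_top_poset: "is_downset (top_poset s) D \<Longrightarrow> finite D \<and> card D \<le> m"
  using is_poset_top_poset[of s] card_top_poset[of s] card_mono[of "fst (top_poset s)" D]
  by (auto simp: is_downset_def is_poset_def intro: finite_subset)

lemma finite_down_closed: "down_closed T \<Longrightarrow> finite T"
  unfolding down_closed_def using finite_elts finite_subset by blast

lemma down_closed_chain_part:
  assumes "down_closed T"
  obtains a where "a \<le> i" "chain_part T s = {..<a}"
proof -
  have sub: "chain_part T s \<subseteq> {..<i}"
    using assms unfolding down_closed_def chain_part_def by auto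
  have "Chain s k \<in> T" if "Chain s j \<in> T" "k \<le> j" for j k
    using assms that sub unfolding down_closed_def chain_part_def by auto
  then have "chain_part T s = {..<card (chain_part T s)}"
    using sub by (intro down_closed_nat_set_eq_lessThan) (auto simp: chain_part_def intro: finite_subset)
  moreover have "card (chain_part T s) \<le> i"
    using sub by (metis card_lessThan card_mono finite_lessThan)
  ultimately show thesis by (rule that[rotated])
qed

lemma down_closed_top_part: "down_closed T \<Longrightarrow> is_downset (top_poset s) (top_part T s)"
  unfolding down_closed_def is_downset_def top_part_def by force

lemma down_closed_chain_part_full:
  assumes "down_closed T" "top_part T s \<noteq> {}"
  shows "chain_part T s = {..<i}"
proof -
  obtain p where "Top s p \<in> T" using assms(2) unfolding top_part_def by blast
  then have "Chain s j \<in> T" if "j < i" for j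
    using assms(1) that le_elt_is_elt[of "Chain s j" "Top s p"]
    unfolding down_closed_def by (metis is_elt.simps(2) le_elt.simps(2) mem_Collect_eq subsetD)
  then show ?thesis using assms(1) unfolding down_closed_def chain_part_def by auto
qed

definition two_chains :: "nat \<Rightarrow> nat \<Rightarrow> tower_elt set" where
  "two_chains a b = Chain False ` {..<a} \<union> Chain True ` {..<b}"

text \<open>The \<open>m + 1 - card D\<close> bottom elements of the other chain bring the size to \<open>m + i + 1\<close>.\<close>
definition topped :: "bool \<Rightarrow> nat set \<Rightarrow> tower_elt set" where
  "topped s D = Chain s ` {..<i} \<union> Top s ` D \<union> Chain (\<not> s) ` {..<m + 1 - card D}"

lemma down_closed_size_cases:
  assumes T: "down_closed T" "card T = m + i + 1"
  obtains (two_chains) a where "m < a" "a \<le> i" "T = two_chains a (m + i + 1 - a)"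
    | (topped) s D where "is_downset (top_poset s) D" "D \<noteq> {}" "T = topped s D"
proof -
  note card = card_tower_set[OF finite_down_closed[OF T(1)]]
  show thesis
  proof (cases "top_part T False = {} \<and> top_part T True = {}")
    case True
    obtain a b where ab: "a \<le> i" "chain_part T False = {..<a}" "b \<le> i" "chain_part T True = {..<b}"
      using down_closed_chain_part[OF T(1)] by metis
    then have "b = m + i + 1 - a" "m < a"
      using card[of False] True T(2) by simp_all
    moreover have "T = two_chains a b"
      using tower_set_decomp[of T False] True ab unfolding two_chains_def by simp
    ultimately show thesis using ab(1) by (intro that(1)[of a]) simp_all
  next
    case False
    then obtain s where s: "top_part T s \<noteq> {}" by blast
    have full: "chain_part T s = {..<i}" using down_closed_chain_part_full[OF T(1) s] .
    show thesis
    proof (cases "top_part T (\<not> s) = {}")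
      case True
      obtain c where c: "chain_part T (\<not> s) = {..<c}"
        using down_closed_chain_part[OF T(1)] by metis
      have "c = m + 1 - card (top_part T s)"
        using card[of s] full True T(2) c by simp
      then have "T = topped s (top_part T s)"
        using tower_set_decomp[of T s] full True c unfolding topped_def by (simp add: Un_ac)
      then show thesis using that(2) down_closed_top_part[OF T(1)] s by blast
    next
      case False
      have "chain_part T (\<not> s) = {..<i}" using down_closed_chain_part_full[OF T(1) False] .
      moreover have "card (top_part T s) \<ge> 1" "card (top_part T (\<not> s)) \<ge> 1"
        using s False down_closed_top_part[OF T(1)] downset_top_poset
        by (metis One_nat_def Suc_leI card_gt_0_iff)+
      ultimately have "card T \<ge> 2 * i + 2" using card[of s] full by simp
      then show thesis using T(2) m_less_i by simp
    qed
  qed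
qed

lemma down_closed_two_chains: "a \<le> i \<Longrightarrow> b \<le> i \<Longrightarrow> down_closed (two_chains a b)"
  unfolding down_closed_def two_chains_def by (auto elim!: le_elt.elims)

lemma card_two_chains: "card (two_chains a b) = a + b"
  unfolding two_chains_def by (subst card_Un_disjoint) (auto simp: card_image inj_on_def)

lemma down_closed_topped: "is_downset (top_poset s) D \<Longrightarrow> down_closed (topped s D)"
  using m_less_i downset_top_poset[of s D] top_poset_le_carrier[of _ _ s]
  unfolding down_closed_def topped_def is_downset_def by (auto elim!: le_elt.elims)

lemma card_topped: assumes "is_downset (top_poset s) D" shows "card (topped s D) = m + i + 1"
proof -
  have "card (topped s D) = i + card D + (m + 1 - card D)"
    unfolding topped_def using downset_top_poset[OF assms]
    by (subst card_Un_disjoint, auto simp: card_image inj_on_def)+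
  then show ?thesis using downset_top_poset[OF assms] by simp
qed

lemma below_count_Chain:
  assumes "down_closed T" "Chain s j \<in> T"
  shows "below_count (PR_on T) (code (Chain s j)) = j"
proof -
  have "j < i" using assms unfolding down_closed_def by auto
  then have "{b \<in> T. le_elt b (Chain s j) \<and> b \<noteq> Chain s j} = Chain s ` {..<j}"
    using assms unfolding down_closed_def by (auto elim!: le_elt.elims)
  then show ?thesis using below_count_PR_on[OF assms(2)] by (simp add: card_image inj_on_def)
qed

lemma has_deep_elem_two_chains:
  assumes "a \<le> i" "b \<le> i"
  shows "has_deep_elem t (PR_on (two_chains a b)) \<longleftrightarrow> t < max a b"
proof
  note count = below_count_Chain[OF down_closed_two_chains[OF assms]]
  assume "has_deep_elem t (PR_on (two_chains a b))"
  then obtain s j where "Chain s j \<in> two_chains a b" "t \<le> below_count (PR_on (two_chains a b)) (code (Chain s j))"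
    unfolding has_deep_elem_def fst_PR_on two_chains_def by auto
  then show "t < max a b" using count unfolding two_chains_def by auto
next
  note count = below_count_Chain[OF down_closed_two_chains[OF assms]]
  assume "t < max a b"
  then obtain s where "Chain s t \<in> two_chains a b"
    unfolding two_chains_def by (auto simp: less_max_iff_disj)
  then show "has_deep_elem t (PR_on (two_chains a b))"
    using count unfolding has_deep_elem_def fst_PR_on
    by (intro bexI[of _ "code (Chain s t)"]) auto
qed

lemma below_count_Top_topped:
  assumes "is_downset (top_poset s) D" "p \<in> D"
  shows "i \<le> below_count (PR_on (topped s D)) (code (Top s p))"
proof -
  have "Chain s ` {..<i} \<subseteq> {b \<in> topped s D. le_elt b (Top s p) \<and> b \<noteq> Top s p}"
    using assms unfolding topped_def is_downset_def by auto
  moreover have "finite (topped s D)"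
    using finite_down_closed[OF down_closed_topped[OF assms(1)]] .
  ultimately have "card (Chain s ` {..<i}) \<le> card {b \<in> topped s D. le_elt b (Top s p) \<and> b \<noteq> Top s p}"
    by (intro card_mono) auto
  moreover have "Top s p \<in> topped s D" using assms(2) unfolding topped_def by blast
  ultimately show ?thesis using below_count_PR_on by (simp add: card_image inj_on_def)
qed

lemma deep_part_topped:
  assumes "is_downset (top_poset s) D"
  shows "deep_part i (PR_on (topped s D)) = PR_on (Top s ` D)"
proof -
  have "m + 1 - card D \<le> i" using m_less_i by simp
  then have "{x \<in> fst (PR_on (topped s D)). i \<le> below_count (PR_on (topped s D)) x} = code ` Top s ` D"
    using below_count_Chain[OF down_closed_topped[OF assms]] below_count_Top_topped[OF assms]
    unfolding fst_PR_on topped_def by auto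
  moreover have "code ` Top s ` D \<subseteq> code ` topped s D" unfolding topped_def by auto
  ultimately show ?thesis unfolding deep_part_def PR_on_def induced_def by auto
qed

lemma has_deep_elem_topped:
  assumes "is_downset (top_poset s) D" "D \<noteq> {}"
  shows "has_deep_elem i (PR_on (topped s D))"
proof -
  obtain p where "p \<in> D" using assms(2) by blast
  then show ?thesis
    using below_count_Top_topped[OF assms(1)] unfolding has_deep_elem_def fst_PR_on topped_def
    by (intro bexI[of _ "code (Top s p)"]) auto
qed

lemma top_poset_iso_PR_on_Top:
  "D \<subseteq> fst (top_poset s) \<Longrightarrow> pos_iso (induced (top_poset s) D) (PR_on (Top s ` D))"
  unfolding PR_on_def image_image
  by (rule pos_iso_inducedI[where f = "\<lambda>p. code (Top s p)"]) (auto simp: bij_betw_def inj_on_def code_le_PR_iff)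

lemma two_chains_swap_iso: "pos_iso (PR_on (two_chains a b)) (PR_on (two_chains b a))"
proof (rule PR_on_iso)
  show "bij_betw (relabel False True id) (two_chains a b) (two_chains b a)"
    by (rule bij_betw_byWitness[where f' = "relabel False True id"])
      (auto simp: two_chains_def)
qed (auto simp: two_chains_def)

lemma topped_iso:
  assumes D: "is_downset (top_poset s) D" and D': "is_downset (top_poset t) D'"
    and iso: "pos_iso (induced (top_poset s) D) (induced (top_poset t) D')"
  shows "pos_iso (PR_on (topped s D)) (PR_on (topped t D'))"
proof -
  obtain g where g: "bij_betw g D D'"
    and le_g: "\<And>p q. p \<in> D \<Longrightarrow> q \<in> D \<Longrightarrow>
      (p, q) \<in> snd (top_poset s) \<longleftrightarrow> (g p, g q) \<in> snd (top_poset t)"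
    using pos_iso_inducedE[OF iso] by blast
  have "relabel s t g ` topped s D = Chain t ` {..<i} \<union> Top t ` g ` D \<union>
      Chain (\<not> t) ` {..<m + 1 - card D}"
    unfolding topped_def by (auto simp: image_Un image_image)
  also have "\<dots> = topped t D'"
    using g bij_betw_same_card[OF g] unfolding topped_def bij_betw_def by simp
  finally have "relabel s t g ` topped s D = topped t D'" .
  moreover have "inj_on (relabel s t g) (topped s D)"
  proof (rule inj_onI)
    fix a b assume "a \<in> topped s D" "b \<in> topped s D" "relabel s t g a = relabel s t g b"
    then show "a = b" using bij_betw_imp_inj_on[OF g] unfolding topped_def inj_on_def
      by (cases a; cases b) (auto split: if_splits)
  qed
  ultimately have "bij_betw (relabel s t g) (topped s D) (topped t D')"
    by (simp add: bij_betw_def)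
  then show ?thesis
  proof (rule PR_on_iso)
    fix a b assume ab: "a \<in> topped s D" "b \<in> topped s D"
    have "D \<subseteq> fst (top_poset s)" "D' \<subseteq> fst (top_poset t)"
      using D D' by (simp_all add: is_downset_def)
    moreover have "g p \<in> D'" if "p \<in> D" for p using g that by (rule bij_betw_apply)
    ultimately show "le_elt (relabel s t g a) (relabel s t g b) \<longleftrightarrow> le_elt a b"
      using ab m_less_i le_g unfolding topped_def by (cases a; cases b) (auto split: if_splits)
  qed
qed

definition chain_classes :: "npos set set" where
  "chain_classes = (\<lambda>a. iso_class (PR_on (two_chains a (m + i + 1 - a)))) ` {m<..i}"

definition top_downsets :: "(bool \<times> nat set) set" where
  "top_downsets = {(s, D). is_downset (top_poset s) D \<and> D \<noteq> {}}"

definition topped_classes :: "npos set set" where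
  "topped_classes = (\<lambda>(s, D). iso_class (PR_on (topped s D))) ` top_downsets"

lemma Dn_PR_eq: "Dn (m + i + 1) PR = chain_classes \<union> topped_classes"
proof (intro equalityI subsetI)
  fix X assume "X \<in> Dn (m + i + 1) PR"
  then obtain T where T: "X = iso_class (PR_on T)" "down_closed T" "card T = m + i + 1"
    unfolding Dn_PR by blast
  from T(2,3) show "X \<in> chain_classes \<union> topped_classes"
  proof (cases rule: down_closed_size_cases)
    case (two_chains a)
    then show ?thesis using T(1) unfolding chain_classes_def by auto
  next
    case (topped s D)
    then have "(s, D) \<in> top_downsets" unfolding top_downsets_def by simp
    then show ?thesis using T(1) topped(3) unfolding topped_classes_def by force
  qed
next
  fix X assume "X \<in> chain_classes \<union> topped_classes"
  then obtain T where T: "X = iso_class (PR_on T)" "down_closed T" "card T = m + i + 1"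
  proof
    assume "X \<in> chain_classes"
    then obtain a where "m < a" "a \<le> i" "X = iso_class (PR_on (two_chains a (m + i + 1 - a)))"
      unfolding chain_classes_def by auto
    then show thesis
      using that down_closed_two_chains[of a "m + i + 1 - a"] card_two_chains[of a "m + i + 1 - a"]
      by simp
  next
    assume "X \<in> topped_classes"
    then obtain s D where "is_downset (top_poset s) D" "X = iso_class (PR_on (topped s D))"
      unfolding topped_classes_def top_downsets_def by auto
    then show thesis using that down_closed_topped card_topped by blast
  qed
  then show "X \<in> Dn (m + i + 1) PR" unfolding Dn_PR by force
qed

lemma iso_class_PR_on_eqD:
  "iso_class (PR_on T) = iso_class (PR_on T') \<Longrightarrow> down_closed T' \<Longrightarrow> pos_iso (PR_on T) (PR_on T')"
  using iso_class_eqD is_poset_PR_on unfolding down_closed_def by blast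

lemma chain_classes_topped_classes_disjoint: "chain_classes \<inter> topped_classes = {}"
proof -
  have False if a: "m < a" "a \<le> i" and sD: "(s, D) \<in> top_downsets"
    and eq: "iso_class (PR_on (two_chains a (m + i + 1 - a))) = iso_class (PR_on (topped s D))"
    for a s D
  proof -
    have D: "is_downset (top_poset s) D" "D \<noteq> {}" using sD unfolding top_downsets_def by auto
    have "pos_iso (PR_on (topped s D)) (PR_on (two_chains a (m + i + 1 - a)))"
      using iso_class_PR_on_eqD[OF eq down_closed_topped[OF D(1)]] by (rule pos_iso_sym)
    then have "has_deep_elem i (PR_on (two_chains a (m + i + 1 - a)))"
      using has_deep_elem_topped[OF D] by (rule has_deep_elem_iso)
    moreover have "m + i + 1 - a \<le> i" using a(1) by simp
    ultimately show False using has_deep_elem_two_chains[of a "m + i + 1 - a" i] a(2) by simp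
  qed
  then show ?thesis unfolding chain_classes_def topped_classes_def by fastforce
qed

lemma iso_class_two_chains_eq_iff:
  assumes "a \<in> {m<..i}" "b \<in> {m<..i}"
  shows "iso_class (PR_on (two_chains a (m + i + 1 - a))) = iso_class (PR_on (two_chains b (m + i + 1 - b)))
    \<longleftrightarrow> max a (m + i + 1 - a) = max b (m + i + 1 - b)"
proof
  assume "iso_class (PR_on (two_chains a (m + i + 1 - a))) = iso_class (PR_on (two_chains b (m + i + 1 - b)))"
  then have "pos_iso (PR_on (two_chains a (m + i + 1 - a))) (PR_on (two_chains b (m + i + 1 - b)))"
    using assms down_closed_two_chains by (intro iso_class_PR_on_eqD) auto
  then have deep_iff: "has_deep_elem t (PR_on (two_chains a (m + i + 1 - a))) \<longleftrightarrow>
      has_deep_elem t (PR_on (two_chains b (m + i + 1 - b)))" for t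
    using has_deep_elem_iso pos_iso_sym by blast
  have "t < max a (m + i + 1 - a) \<longleftrightarrow> t < max b (m + i + 1 - b)" for t
  proof -
    have "a \<le> i" "m + i + 1 - a \<le> i" "b \<le> i" "m + i + 1 - b \<le> i" using assms by auto
    then show ?thesis using deep_iff[of t] has_deep_elem_two_chains by simp
  qed
  then show "max a (m + i + 1 - a) = max b (m + i + 1 - b)"
    by (metis less_irrefl nat_neq_iff)
next
  assume "max a (m + i + 1 - a) = max b (m + i + 1 - b)"
  then have "b = a \<or> b = m + i + 1 - a" using assms by auto
  then show "iso_class (PR_on (two_chains a (m + i + 1 - a))) = iso_class (PR_on (two_chains b (m + i + 1 - b)))"
  proof
    assume b: "b = m + i + 1 - a"
    then have "m + i + 1 - b = a" using assms by auto
    then show ?thesis using b iso_class_eq[OF two_chains_swap_iso] by simp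
  qed simp
qed

lemma card_chain_classes: "card chain_classes = (i - m + 1) div 2"
proof -
  let ?n = "m + i + 1"
  have "card chain_classes = card ((\<lambda>a. max a (?n - a)) ` {m<..i})"
    unfolding chain_classes_def by (rule card_image_eq_if_same_kernel) (rule iso_class_two_chains_eq_iff)
  also have "(\<lambda>a. max a (?n - a)) ` {m<..i} = {(?n + 1) div 2..i}"
  proof (intro equalityI subsetI)
    fix c assume "c \<in> {(?n + 1) div 2..i}"
    then have "c = max c (?n - c)" "c \<in> {m<..i}" by auto
    then show "c \<in> (\<lambda>a. max a (?n - a)) ` {m<..i}" by (rule image_eqI)
  qed auto
  also have "card {(?n + 1) div 2..i} = (i - m + 1) div 2"
    using m_less_i by simp
  finally show ?thesis .
qed

lemma Dsets_top_posets: "Dsets P0 \<union> Dsets R0 = (\<lambda>(s, D). iso_class (induced (top_poset s) D)) ` top_downsets"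
proof (intro equalityI subsetI)
  fix X assume "X \<in> Dsets P0 \<union> Dsets R0"
  then obtain s where "X \<in> Dsets (top_poset s)" by (metis Un_iff top_poset_False top_poset_True)
  then obtain D where "X = iso_class (induced (top_poset s) D)" "(s, D) \<in> top_downsets"
    unfolding Dsets_def top_downsets_def by blast
  then show "X \<in> (\<lambda>(s, D). iso_class (induced (top_poset s) D)) ` top_downsets"
    by (auto intro: image_eqI[where x = "(s, D)"])
next
  fix X assume "X \<in> (\<lambda>(s, D). iso_class (induced (top_poset s) D)) ` top_downsets"
  then obtain s D where "X = iso_class (induced (top_poset s) D)" "(s, D) \<in> top_downsets" by auto
  then have "X \<in> Dsets (top_poset s)" unfolding Dsets_def top_downsets_def by blast
  then show "X \<in> Dsets P0 \<union> Dsets R0" by (cases s) auto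
qed

lemma iso_class_topped_eq_iff:
  assumes "(s, D) \<in> top_downsets" "(t, D') \<in> top_downsets"
  shows "iso_class (PR_on (topped s D)) = iso_class (PR_on (topped t D')) \<longleftrightarrow>
    iso_class (induced (top_poset s) D) = iso_class (induced (top_poset t) D')"
proof
  have D: "is_downset (top_poset s) D" and D': "is_downset (top_poset t) D'"
    using assms unfolding top_downsets_def by auto
  then have sub: "D \<subseteq> fst (top_poset s)" "D' \<subseteq> fst (top_poset t)" by (simp_all add: is_downset_def)
  {
    assume "iso_class (PR_on (topped s D)) = iso_class (PR_on (topped t D'))"
    then have "pos_iso (PR_on (topped s D)) (PR_on (topped t D'))"
      using iso_class_PR_on_eqD down_closed_topped[OF D'] by blast
    then have "pos_iso (PR_on (Top s ` D)) (PR_on (Top t ` D'))"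
      using deep_part_iso deep_part_topped[OF D] deep_part_topped[OF D'] by metis
    then have "pos_iso (induced (top_poset s) D) (induced (top_poset t) D')"
      using top_poset_iso_PR_on_Top[OF sub(1)] top_poset_iso_PR_on_Top[OF sub(2)]
      by (metis pos_iso_sym pos_iso_trans)
    then show "iso_class (induced (top_poset s) D) = iso_class (induced (top_poset t) D')"
      by (rule iso_class_eq)
  }
  {
    assume "iso_class (induced (top_poset s) D) = iso_class (induced (top_poset t) D')"
    then have "pos_iso (induced (top_poset s) D) (induced (top_poset t) D')"
      using iso_class_eqD induced_poset[OF is_poset_top_poset sub(2)] by blast
    then show "iso_class (PR_on (topped s D)) = iso_class (PR_on (topped t D'))"
      using topped_iso[OF D D'] iso_class_eq by blast
  }
qed

lemma card_topped_classes: "card topped_classes = card (Dsets P0 \<union> Dsets R0)"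
  unfolding topped_classes_def Dsets_top_posets
proof (rule card_image_eq_if_same_kernel)
  fix x y assume "x \<in> top_downsets" "y \<in> top_downsets"
  then show "(\<lambda>(s, D). iso_class (PR_on (topped s D))) x = (\<lambda>(s, D). iso_class (PR_on (topped s D))) y \<longleftrightarrow>
    (\<lambda>(s, D). iso_class (induced (top_poset s) D)) x = (\<lambda>(s, D). iso_class (induced (top_poset s) D)) y"
    by (cases x; cases y) (simp add: iso_class_topped_eq_iff)
qed

lemma card_Dn_PR: "card (Dn (m + i + 1) PR) = Cconst P0 R0 + (i - m + 1) div 2"
proof -
  have "finite (Dn (m + i + 1) PR)"
    using finite_Dsets[OF is_poset_PR] unfolding Dn_def Dsets_def
    by (rule finite_subset[rotated]) blast
  then have "finite chain_classes" "finite topped_classes" unfolding Dn_PR_eq by simp_all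
  then have "card (Dn (m + i + 1) PR) = card chain_classes + card topped_classes"
    unfolding Dn_PR_eq using chain_classes_topped_classes_disjoint by (rule card_Un_disjoint)
  moreover have "card (Dsets P0 \<union> Dsets R0) = Cconst P0 R0"
    using card_Un_Int[OF finite_Dsets[OF P0] finite_Dsets[OF R0]] unfolding Cconst_def by simp
  ultimately show ?thesis using card_chain_classes card_topped_classes by simp
qed

subsection \<open>Minimal witnesses\<close>

lemma downset_carrier: "is_downset (top_poset s) (fst (top_poset s))"
  using is_poset_top_poset[of s] unfolding is_downset_def is_poset_def by auto

lemma topped_carrier_eq: "topped s (fst (top_poset s)) =
    insert (Chain (\<not> s) 0) (Chain s ` {..<i} \<union> Top s ` fst (top_poset s))"
  unfolding topped_def card_top_poset by auto

lemma point_plus_rooted_topped_carrier: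
  "point_plus_rooted PR (code ` topped s (fst (top_poset s))) (code (Chain (\<not> s) 0)) (code (Chain s 0))"
  unfolding point_plus_rooted_def topped_carrier_eq using m_less_i by (auto simp: code_le_PR_iff)

lemma topped_carriers_not_iso:
  "\<not> pos_iso (PR_on (topped False (fst (top_poset False)))) (PR_on (topped True (fst (top_poset True))))"
proof
  assume "pos_iso (PR_on (topped False (fst (top_poset False)))) (PR_on (topped True (fst (top_poset True))))"
  from deep_part_iso[OF this, of i]
  have "pos_iso (PR_on (Top False ` fst (top_poset False))) (PR_on (Top True ` fst (top_poset True)))"
    by (simp only: deep_part_topped[OF downset_carrier])
  then have "pos_iso (induced (top_poset False) (fst (top_poset False))) (induced (top_poset True) (fst (top_poset True)))"
    using top_poset_iso_PR_on_Top[OF order_refl] pos_iso_sym pos_iso_trans by metis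
  then show False using not_iso induced_carrier[OF P0] induced_carrier[OF R0] by simp
qed

lemma no_least_PR_on:
  assumes "down_closed T" "card T = m + i + 1"
  shows "\<not> has_least (PR_on T)"
proof
  have "Chain False 0 \<in> T \<and> Chain True 0 \<in> T"
    using assms
  proof (cases rule: down_closed_size_cases)
    case (topped s D)
    then show ?thesis using downset_top_poset[OF topped(1)] m_less_i unfolding topped_def by (cases s) auto
  qed (auto simp: two_chains_def)
  moreover assume "has_least (PR_on T)"
  then obtain a where "a \<in> T" "\<forall>b\<in>T. le_elt a b"
    unfolding has_least_def PR_on_def induced_def by (auto simp: code_le_PR_iff)
  ultimately have "le_elt a (Chain False 0)" "le_elt a (Chain True 0)" by blast+
  then show False by (cases a) auto
qed

lemma Dn_eq_realizes:
  assumes "Dn (m + i + 1) Q = Dn (m + i + 1) PR" "down_closed T" "card T = m + i + 1"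
  obtains A where "is_downset Q A" "card A = m + i + 1" "pos_iso (induced Q A) (PR_on T)"
proof -
  have "T \<noteq> {}" using assms(3) by auto
  then have "iso_class (PR_on T) \<in> Dn (m + i + 1) Q" using assms unfolding Dn_PR by blast
  then obtain A where "iso_class (PR_on T) = iso_class (induced Q A)" "is_downset Q A" "card A = m + i + 1"
    unfolding Dn_def by blast
  moreover have "is_poset (PR_on T)" using assms(2) is_poset_PR_on unfolding down_closed_def by blast
  ultimately show thesis using that iso_class_eqD by metis
qed

lemma Dn_eq_realized:
  assumes "Dn (m + i + 1) Q = Dn (m + i + 1) PR" "is_downset Q A" "card A = m + i + 1"
  obtains T where "down_closed T" "card T = m + i + 1" "pos_iso (induced Q A) (PR_on T)"
proof -
  have "A \<noteq> {}" using assms(3) by auto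
  then have "iso_class (induced Q A) \<in> Dn (m + i + 1) PR" using assms unfolding Dn_def by blast
  then obtain T where "iso_class (induced Q A) = iso_class (PR_on T)" "down_closed T" "card T = m + i + 1"
    unfolding Dn_PR by blast
  moreover have "is_poset (PR_on T)" using calculation(2) is_poset_PR_on unfolding down_closed_def by blast
  ultimately show thesis using that iso_class_eqD by metis
qed

lemma psize_witness_ge:
  assumes Q: "is_poset Q" and D: "Dn (m + i + 1) Q = Dn (m + i + 1) PR"
  shows "psize PR \<le> psize Q"
proof -
  let ?n = "m + i + 1"
  have realized: "\<exists>A u v. is_downset Q A \<and> card A = ?n \<and>
      pos_iso (induced Q A) (PR_on (topped s (fst (top_poset s)))) \<and> point_plus_rooted Q A u v" for s
  proof -
    obtain A where A: "is_downset Q A" "card A = ?n" "pos_iso (induced Q A) (PR_on (topped s (fst (top_poset s))))"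
      using Dn_eq_realizes[OF D down_closed_topped card_topped] downset_carrier by metis
    moreover have "\<exists>u v. point_plus_rooted Q A u v"
      using point_plus_rooted_iso[OF pos_iso_sym[OF A(3)[unfolded PR_on_def]] point_plus_rooted_topped_carrier] .
    ultimately show ?thesis by blast
  qed
  obtain A uA vA where A: "is_downset Q A" "card A = ?n" "point_plus_rooted Q A uA vA"
    "pos_iso (induced Q A) (PR_on (topped False (fst (top_poset False))))"
    using realized[of False] by blast
  obtain B uB vB where B: "is_downset Q B" "card B = ?n" "point_plus_rooted Q B uB vB"
    "pos_iso (induced Q B) (PR_on (topped True (fst (top_poset True))))"
    using realized[of True] by blast
  have "\<not> pos_iso (induced Q A) (induced Q B)"
    using A(4) B(4) topped_carriers_not_iso pos_iso_sym pos_iso_trans by metis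
  moreover have "\<not> has_least (induced Q T)" if "is_downset Q T" "card T = ?n" for T
    using Dn_eq_realized[OF D that] no_least_PR_on has_least_iso by metis
  ultimately have "2 * ?n - 2 \<le> card (A \<union> B)"
    using card_Un_point_plus_rooted_downsets[OF Q A(1-3) B(1-3)] by blast
  moreover have "card (A \<union> B) \<le> psize Q"
    unfolding psize_def using A(1) B(1) Q by (intro card_mono) (auto simp: is_downset_def is_poset_def)
  ultimately show ?thesis using psize_PR by simp
qed

end

lemma ceiling_half_diff: "m \<le> i \<Longrightarrow> \<lceil>(real i - real m) / 2\<rceil> = int ((i - m + 1) div 2)"
proof -
  assume "m \<le> i"
  then have "(real i - real m) / 2 = of_int (int (i - m)) / of_int 2" by simp
  then have "\<lceil>(real i - real m) / 2\<rceil> = - (- int (i - m) div 2)"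
    by (simp only: ceiling_divide_eq_div)
  then show ?thesis by presburger
qed

theorem mainTheorem6:
  fixes P0 R0 :: npos and m i :: nat
  assumes "is_poset P0" and "is_poset R0" and "\<not> pos_iso P0 R0"
    and "psize P0 = m" and "psize R0 = m" and "i > m"
  shows "let PR = disj_union (above_chain P0 i) (above_chain R0 i);
             n = m + i + 1;
             \<Gamma> = Dn n PR;
             k = Cconst P0 R0 + nat \<lceil>(real i - real m) / 2\<rceil>
         in is_covtree_node n \<Gamma>
            \<and> (\<forall>X\<in>\<Gamma>. \<forall>Q\<in>X. psize Q = n)
            \<and> card \<Gamma> = k
            \<and> is_witness n \<Gamma> PR
            \<and> (\<forall>Q. is_witness n \<Gamma> Q \<longrightarrow> psize PR \<le> psize Q)
            \<and> psize PR = 2 * m + 2 * i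
            \<and> (\<forall>c::real. real i - of_int \<lceil>(real i - real m) / 2\<rceil>
                          > 1 + real (Cconst P0 R0) - real m + c
                 \<longrightarrow> real (psize PR) > real n + real k + c)"
proof -
  interpret two_towers P0 R0 m i using assms by unfold_locales
  have ceiling: "\<lceil>(real i - real m) / 2\<rceil> = int ((i - m + 1) div 2)"
    using assms(6) by (simp add: ceiling_half_diff)
  have witness: "is_witness (m + i + 1) (Dn (m + i + 1) PR) PR"
    using is_poset_PR by (simp add: is_witness_def)
  have node: "is_covtree_node (m + i + 1) (Dn (m + i + 1) PR)"
    using witness unfolding is_covtree_node_def by blast
  have minimal: "\<forall>Q. is_witness (m + i + 1) (Dn (m + i + 1) PR) Q \<longrightarrow> psize PR \<le> psize Q"
    using psize_witness_ge by (simp add: is_witness_def)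
  show ?thesis
    unfolding Let_def PR_def[symmetric]
    using node witness minimal psize_Dn_member card_Dn_PR psize_PR ceiling by auto
qed

end
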